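(* Let $X$ and $Y$ be connected, locally path-connected, semilocally simply connected spaces, and let $f_1,\dots,f_k:X\to Y$ be maps with induced homomorphisms $\phi_1,\dots,\phi_k:\pi_1(X)\to\pi_1(Y)$. The assignment $$\Psi([(\alpha_2,\ldots,\alpha_k)])=([\alpha_2],\ldots,[\alpha_k])$$ is a well-defined surjection $$\Psi:\mathcal R(\phi_1,\ldots,\phi_k)\to\mathcal R(\phi_1,\phi_2)\times\cdots\times\mathcal R(\phi_1,\phi_k).$$ Therefore, if $R(\phi_1,\ldots,\phi_k)<\infty$, then $R(\phi_1,\phi_j)<\infty$ for $j=2,\ldots,k$ and $$R(\phi_1,\ldots,\phi_k)\ge R(\phi_1,\phi_2)\cdots R(\phi_1,\phi_k).$$
   Context: For homomorphisms $\phi_1,\dots,\phi_k:\pi_1(X)\to\pi_1(Y)$ ($k\ge2$), put on $\pi_1(Y)^{k-1}$ the equivalence relation $(\alpha_2,\dots,\alpha_k)\sim(\beta_2,\dots,\beta_k)$ iff there is $z\in\pi_1(X)$ with $\beta_i=\phi_1(z)\alpha_i\phi_i(z)^{-1}$ for all $i=2,\dots,k$. The quotient set is $\mathcal R(\phi_1,\dots,\phi_k)$, with classes denoted $[(\alpha_2,\dots,\alpha_k)]$, and its cardinality is the Reidemeister number $R(\phi_1,\dots,\phi_k)$. In particular $\mathcal R(\phi_1,\phi_j)$ is the quotient of $\pi_1(Y)$ by $\alpha\sim\phi_1(z)\alpha\phi_j(z)^{-1}$, $z\in\pi_1(X)$. *)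

theory Defs
  imports "HOL-Analysis.Analysis" "HOL-Algebra.Group" "HOL-Library.Extended_Nat"
begin

section \<open>Fundamental groups\<close>

text \<open>
  A topological space is a subset of a type of class \<^class>\<open>topological_space\<close>, with the subspace
  topology. No separation axiom is assumed; in particular constant paths are written
  \<open>\<lambda>_. x\<close>, because \<^const>\<open>linepath\<close> needs a vector space.
\<close>

definition based_loops :: "'a::topological_space set \<Rightarrow> 'a \<Rightarrow> (real \<Rightarrow> 'a) set" where
  "based_loops X x = {p. path p \<and> path_image p \<subseteq> X \<and> pathstart p = x \<and> pathfinish p = x}"

definition path_class :: "'a::topological_space set \<Rightarrow> (real \<Rightarrow> 'a) \<Rightarrow> (real \<Rightarrow> 'a) set" where
  "path_class X p = {q. homotopic_paths X p q}"

definition pi1 :: "'a::topological_space set \<Rightarrow> 'a \<Rightarrow> (real \<Rightarrow> 'a) set monoid" where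
  "pi1 X x =
    \<lparr>carrier = path_class X ` based_loops X x,
     monoid.mult = (\<lambda>A B. \<Union>p\<in>A. \<Union>q\<in>B. path_class X (p +++ q)),
     one = path_class X (\<lambda>_. x)\<rparr>"

definition semilocally_simply_connected :: "'a::topological_space set \<Rightarrow> bool" where
  "semilocally_simply_connected X \<longleftrightarrow>
    (\<forall>x\<in>X. \<exists>U. openin (top_of_set X) U \<and> x \<in> U \<and>
      (\<forall>p\<in>based_loops U x. homotopic_paths X p (\<lambda>_. x)))"

text \<open>
  The homomorphism induced by a map \<open>f\<close> from \<open>X\<close> to \<open>Y\<close>. As \<open>f\<close> need not send the base point \<open>x\<close>
  of \<open>X\<close> to the base point \<open>y\<close> of \<open>Y\<close>, it depends on a path \<open>w\<close> in \<open>Y\<close> from \<open>y\<close> to \<open>f x\<close>: the class of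
  a loop \<open>p\<close> is sent to the class of \<open>w\<close>, followed by \<open>f \<circ> p\<close>, followed by the reverse of \<open>w\<close>.
  When universal covers exist, choosing the homotopy class of \<open>w\<close> amounts to choosing a lift of
  \<open>f\<close> to the universal covers. If \<open>f x = y\<close> and \<open>w\<close> is constant, this is the usual induced
  homomorphism.
\<close>

definition induced_hom ::
  "'b::topological_space set \<Rightarrow> (real \<Rightarrow> 'b) \<Rightarrow> ('a::topological_space \<Rightarrow> 'b)
    \<Rightarrow> (real \<Rightarrow> 'a) set \<Rightarrow> (real \<Rightarrow> 'b) set" where
  "induced_hom Y w f A = (\<Union>p\<in>A. path_class Y (w +++ (f \<circ> p) +++ reversepath w))"


section \<open>Reidemeister classes\<close>

text \<open>
  For \<open>\<phi> 1, \<dots>, \<phi> k\<close> from \<open>G\<close> to \<open>H\<close>, a tuple \<open>(\<alpha>\<^sub>2, \<dots>, \<alpha>\<^sub>k)\<close> in \<open>H\<^sup>k\<^sup>-\<^sup>1\<close> is an extensional function on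
  \<open>{2..k}\<close>.
\<close>

definition tuples :: "('h, 'n) monoid_scheme \<Rightarrow> nat \<Rightarrow> (nat \<Rightarrow> 'h) set" where
  "tuples H k = {2..k} \<rightarrow>\<^sub>E carrier H"

definition reidemeister_rel ::
  "('g, 'm) monoid_scheme \<Rightarrow> ('h, 'n) monoid_scheme \<Rightarrow> nat \<Rightarrow> (nat \<Rightarrow> 'g \<Rightarrow> 'h)
    \<Rightarrow> ((nat \<Rightarrow> 'h) \<times> (nat \<Rightarrow> 'h)) set" where
  "reidemeister_rel G H k \<phi> =
    {(\<alpha>, \<beta>). \<alpha> \<in> tuples H k \<and> \<beta> \<in> tuples H k \<and>
      (\<exists>z\<in>carrier G. \<forall>i\<in>{2..k}. \<beta> i = \<phi> 1 z \<otimes>\<^bsub>H\<^esub> \<alpha> i \<otimes>\<^bsub>H\<^esub> inv\<^bsub>H\<^esub> (\<phi> i z))}"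

definition reidemeister_classes ::
  "('g, 'm) monoid_scheme \<Rightarrow> ('h, 'n) monoid_scheme \<Rightarrow> nat \<Rightarrow> (nat \<Rightarrow> 'g \<Rightarrow> 'h)
    \<Rightarrow> (nat \<Rightarrow> 'h) set set" where
  "reidemeister_classes G H k \<phi> = tuples H k // reidemeister_rel G H k \<phi>"

text \<open>
  The case of two homomorphisms, where 1-tuples are identified with elements of \<open>H\<close>.
\<close>

definition reidemeister_rel2 ::
  "('g, 'm) monoid_scheme \<Rightarrow> ('h, 'n) monoid_scheme \<Rightarrow> ('g \<Rightarrow> 'h) \<Rightarrow> ('g \<Rightarrow> 'h)
    \<Rightarrow> ('h \<times> 'h) set" where
  "reidemeister_rel2 G H \<phi> \<psi> =
    {(\<alpha>, \<beta>). \<alpha> \<in> carrier H \<and> \<beta> \<in> carrier H \<and>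
      (\<exists>z\<in>carrier G. \<beta> = \<phi> z \<otimes>\<^bsub>H\<^esub> \<alpha> \<otimes>\<^bsub>H\<^esub> inv\<^bsub>H\<^esub> (\<psi> z))}"

definition reidemeister_classes2 ::
  "('g, 'm) monoid_scheme \<Rightarrow> ('h, 'n) monoid_scheme \<Rightarrow> ('g \<Rightarrow> 'h) \<Rightarrow> ('g \<Rightarrow> 'h) \<Rightarrow> 'h set set" where
  "reidemeister_classes2 G H \<phi> \<psi> = carrier H // reidemeister_rel2 G H \<phi> \<psi>"

text \<open>Cardinality in \<open>\<nat> \<union> {\<infinity>}\<close>; note that \<^const>\<open>card\<close> alone is 0 on infinite sets.\<close>

definition ecard :: "'c set \<Rightarrow> enat" where
  "ecard S = (if finite S then enat (card S) else \<infinity>)"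

definition reidemeister_number ::
  "('g, 'm) monoid_scheme \<Rightarrow> ('h, 'n) monoid_scheme \<Rightarrow> nat \<Rightarrow> (nat \<Rightarrow> 'g \<Rightarrow> 'h) \<Rightarrow> enat" where
  "reidemeister_number G H k \<phi> = ecard (reidemeister_classes G H k \<phi>)"

definition reidemeister_number2 ::
  "('g, 'm) monoid_scheme \<Rightarrow> ('h, 'n) monoid_scheme \<Rightarrow> ('g \<Rightarrow> 'h) \<Rightarrow> ('g \<Rightarrow> 'h) \<Rightarrow> enat" where
  "reidemeister_number2 G H \<phi> \<psi> = ecard (reidemeister_classes2 G H \<phi> \<psi>)"

end

theory Submission
  imports Defs
begin

section \<open>The fundamental group\<close>

text \<open>
  The library proves the unit and inverse laws only in normed spaces. In a general space, \<open>p\<close> is the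
  image under \<open>p\<close> of the identity path of \<open>[0,1]\<close>, so the laws follow from those for that path.
\<close>

lemma path_id: "path (id :: real \<Rightarrow> real)" "path_image (id :: real \<Rightarrow> real) = {0..1}"
  by (auto simp: path_def path_image_def)

lemma homotopic_paths_image_unit_interval:
  assumes "homotopic_paths {0..1} a b" "path p" "path_image p \<subseteq> S"
  shows "homotopic_paths S (p \<circ> a) (p \<circ> b)"
  using assms by (intro homotopic_paths_continuous_image) (auto simp: path_def path_image_def)

lemma homotopic_paths_rid_const:
  assumes "path p" "path_image p \<subseteq> S"
  shows "homotopic_paths S (p +++ (\<lambda>_. pathfinish p)) p"
proof -
  have "p +++ (\<lambda>_. pathfinish p) = p \<circ> (id +++ linepath 1 1)"
    by (auto simp: joinpaths_def pathfinish_def linepath_refl)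
  then show ?thesis
    using homotopic_paths_image_unit_interval[OF homotopic_paths_rid assms, of id]
    by (simp add: path_id pathfinish_def)
qed

lemma homotopic_paths_rinv_const:
  assumes "path p" "path_image p \<subseteq> S"
  shows "homotopic_paths S (p +++ reversepath p) (\<lambda>_. pathstart p)"
proof -
  \<comment> \<open>The path \<open>id +++ reversepath id\<close> runs through [0,1] and back. It
    contracts to the constant path at 0 inside [0,1], and \<open>p\<close> carries this contraction
    into \<open>S\<close>.\<close>
  have "p +++ reversepath p = p \<circ> (id +++ reversepath id)"
    and "(\<lambda>_. pathstart p) = p \<circ> linepath 0 0"
    by (auto simp: joinpaths_def reversepath_def pathstart_def linepath_refl)
  then show ?thesis
    using homotopic_paths_image_unit_interval[OF homotopic_paths_rinv assms, of id]
    by (simp add: path_id pathstart_def)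
qed

lemma homotopic_paths_lid_const:
  assumes "path p" "path_image p \<subseteq> S"
  shows "homotopic_paths S ((\<lambda>_. pathstart p) +++ p) p"
proof -
  have "(\<lambda>_. pathstart p) +++ p = p \<circ> (linepath 0 0 +++ id)"
    by (auto simp: joinpaths_def pathstart_def linepath_refl)
  then show ?thesis
    using homotopic_paths_image_unit_interval[OF homotopic_paths_lid assms, of id]
    by (simp add: path_id pathstart_def)
qed

lemma homotopic_paths_linv_const:
  assumes "path p" "path_image p \<subseteq> S"
  shows "homotopic_paths S (reversepath p +++ p) (\<lambda>_. pathfinish p)"
  using homotopic_paths_rinv_const[of "reversepath p" S] assms by simp

text \<open>Deletes a detour back along \<open>w\<close> and out again in the middle of a composite
  path. This is the cancellation that makes conjugation by \<open>w\<close> multiplicative;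
  reassociating brings \<open>reversepath w\<close> next to \<open>w\<close>, and their composite
  contracts to a constant.\<close>

lemma homotopic_paths_cancel:
  assumes a: "path a" "path_image a \<subseteq> S" and w: "path w" "path_image w \<subseteq> S"
    and c: "path c" "path_image c \<subseteq> S"
    and ends: "pathfinish a = pathfinish w" "pathstart c = pathfinish w"
  shows "homotopic_paths S ((a +++ reversepath w) +++ (w +++ c)) (a +++ c)"
proof -
  have "homotopic_paths S ((a +++ reversepath w) +++ (w +++ c)) (a +++ (reversepath w +++ (w +++ c)))"
    by (rule homotopic_paths_sym, rule homotopic_paths_assoc)
      (use assms in \<open>auto simp: subset_path_image_join\<close>)
  also have "homotopic_paths S (reversepath w +++ (w +++ c)) ((reversepath w +++ w) +++ c)"
    by (rule homotopic_paths_assoc) (use assms in \<open>auto simp: subset_path_image_join\<close>)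
  then have "homotopic_paths S (reversepath w +++ (w +++ c)) ((\<lambda>_. pathfinish w) +++ c)"
    by (rule homotopic_paths_trans)
      (use assms in \<open>auto intro!: homotopic_paths_join homotopic_paths_linv_const\<close>)
  then have "homotopic_paths S (reversepath w +++ (w +++ c)) c"
    using homotopic_paths_lid_const[OF c] homotopic_paths_trans ends by metis
  then have "homotopic_paths S (a +++ (reversepath w +++ (w +++ c))) (a +++ c)"
    by (intro homotopic_paths_join) (use assms in auto)
  finally show ?thesis .
qed

section \<open>Homotopy classes of loops and the group they form\<close>

lemma path_class_eqI: "homotopic_paths X p q \<Longrightarrow> path_class X p = path_class X q"
  unfolding path_class_def by (blast intro: homotopic_paths_sym homotopic_paths_trans)

lemma path_class_self: "p \<in> based_loops X x \<Longrightarrow> p \<in> path_class X p"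
  by (simp add: path_class_def based_loops_def)

lemma based_loops_join: "\<lbrakk>p \<in> based_loops X x; q \<in> based_loops X x\<rbrakk> \<Longrightarrow> p +++ q \<in> based_loops X x"
  by (auto simp: based_loops_def subset_path_image_join)

lemma based_loops_reversepath: "p \<in> based_loops X x \<Longrightarrow> reversepath p \<in> based_loops X x"
  by (auto simp: based_loops_def)

lemma based_loops_const: "x \<in> X \<Longrightarrow> (\<lambda>_. x) \<in> based_loops X x"
  by (auto simp: based_loops_def path_def pathstart_def pathfinish_def)

lemma pi1_carrierE:
  assumes "A \<in> carrier (pi1 X x)"
  obtains p where "p \<in> based_loops X x" "A = path_class X p"
  using assms by (auto simp: pi1_def)

lemma pi1_carrierI: "p \<in> based_loops X x \<Longrightarrow> path_class X p \<in> carrier (pi1 X x)"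
  by (simp add: pi1_def)

text \<open>The product in \<open>pi1\<close> is a union over all representatives of both factors.
  Joining respects homotopy, so all the sets in this union coincide, and each class contains its own
  representative, so the union is not empty. Products can then be computed on any chosen
  loops.\<close>

lemma pi1_mult:
  assumes "p \<in> based_loops X x" "q \<in> based_loops X x"
  shows "path_class X p \<otimes>\<^bsub>pi1 X x\<^esub> path_class X q = path_class X (p +++ q)"
proof -
  have "path_class X (p' +++ q') = path_class X (p +++ q)"
    if "p' \<in> path_class X p" "q' \<in> path_class X q" for p' q'
    by (intro path_class_eqI homotopic_paths_sym[OF homotopic_paths_join])
      (use assms that in \<open>auto simp: based_loops_def path_class_def\<close>)
  then show ?thesis
    unfolding pi1_def monoid.simps
    using path_class_self[OF assms(1)] path_class_self[OF assms(2)] by blast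
qed

lemma group_pi1:
  assumes "x \<in> X"
  shows "group (pi1 X x)"
proof (rule groupI)
  have one: "\<one>\<^bsub>pi1 X x\<^esub> = path_class X (\<lambda>_. x)"
    by (simp add: pi1_def)
  show "\<one>\<^bsub>pi1 X x\<^esub> \<in> carrier (pi1 X x)"
    using pi1_carrierI[OF based_loops_const[OF assms]] by (simp add: one)
  fix A assume A: "A \<in> carrier (pi1 X x)"
  then obtain p where p: "p \<in> based_loops X x" "A = path_class X p"
    by (rule pi1_carrierE)
  show "\<one>\<^bsub>pi1 X x\<^esub> \<otimes>\<^bsub>pi1 X x\<^esub> A = A"
    using homotopic_paths_lid_const[of p X] p based_loops_const[OF assms]
    by (simp add: one pi1_mult) (auto simp: based_loops_def intro!: path_class_eqI)
  have "path_class X (reversepath p) \<otimes>\<^bsub>pi1 X x\<^esub> A = \<one>\<^bsub>pi1 X x\<^esub>"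
    using homotopic_paths_linv_const[of p X] p based_loops_reversepath[OF p(1)]
    by (simp add: one pi1_mult) (auto simp: based_loops_def intro!: path_class_eqI)
  then show "\<exists>B\<in>carrier (pi1 X x). B \<otimes>\<^bsub>pi1 X x\<^esub> A = \<one>\<^bsub>pi1 X x\<^esub>"
    using pi1_carrierI[OF based_loops_reversepath[OF p(1)]] by blast
  fix B assume "B \<in> carrier (pi1 X x)"
  then obtain q where q: "q \<in> based_loops X x" "B = path_class X q"
    by (rule pi1_carrierE)
  show "A \<otimes>\<^bsub>pi1 X x\<^esub> B \<in> carrier (pi1 X x)"
    using p q by (simp add: pi1_mult pi1_carrierI based_loops_join)
  fix C assume "C \<in> carrier (pi1 X x)"
  then obtain r where r: "r \<in> based_loops X x" "C = path_class X r"
    by (rule pi1_carrierE)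
  have "homotopic_paths X (p +++ (q +++ r)) ((p +++ q) +++ r)"
    by (rule homotopic_paths_assoc) (use p q r in \<open>auto simp: based_loops_def\<close>)
  then show "(A \<otimes>\<^bsub>pi1 X x\<^esub> B) \<otimes>\<^bsub>pi1 X x\<^esub> C = A \<otimes>\<^bsub>pi1 X x\<^esub> (B \<otimes>\<^bsub>pi1 X x\<^esub> C)"
    using p q r by (simp add: pi1_mult based_loops_join path_class_eqI)
qed

section \<open>Induced homomorphisms\<close>

lemma induced_hom_path_class:
  assumes p: "p \<in> based_loops X x"
    and f: "continuous_on X f" "f \<in> X \<rightarrow> Y"
    and w: "path w" "path_image w \<subseteq> Y" "pathfinish w = f x"
  shows "induced_hom Y w f (path_class X p) = path_class Y (w +++ (f \<circ> p) +++ reversepath w)"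
proof -
  \<comment> \<open>All sets in the union defining \<open>induced_hom\<close> coincide: composing
    with \<open>f\<close> and conjugating by \<open>w\<close> both preserve homotopy. Homotopies of
    paths fix endpoints, so \<open>q\<close> is again a loop at \<open>x\<close> and
    \<open>f \<circ> q\<close> can be joined to \<open>w\<close>.\<close>
  have "path_class Y (w +++ (f \<circ> q) +++ reversepath w) = path_class Y (w +++ (f \<circ> p) +++ reversepath w)"
    if "q \<in> path_class X p" for q
  proof -
    have "homotopic_paths X q p"
      using that by (simp add: path_class_def homotopic_paths_sym_eq)
    then have "homotopic_paths Y (f \<circ> q) (f \<circ> p)"
      and "pathstart q = x" "pathfinish q = x"
      using f p homotopic_paths_imp_pathstart[of X q p] homotopic_paths_imp_pathfinish[of X q p]
      by (auto intro: homotopic_paths_continuous_image simp: based_loops_def)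
    then show ?thesis
      using w by (intro path_class_eqI homotopic_paths_join)
        (auto simp: pathstart_compose pathfinish_compose)
  qed
  then show ?thesis
    unfolding induced_hom_def using path_class_self[OF p] by blast
qed

text \<open>Write a and b for the images of two loops at \<open>x\<close>. In (w a w^-1)(w b w^-1)
  the inner w^-1 w cancels up to homotopy, leaving w (a b) w^-1. Since \<open>w\<close> starts at
  \<open>y\<close>, the conjugated loops are based at \<open>y\<close> even if \<open>f x\<close>
  differs from \<open>y\<close>.\<close>

lemma induced_hom_hom:
  assumes x: "x \<in> X"
    and f: "continuous_on X f" "f \<in> X \<rightarrow> Y"
    and w: "path w" "path_image w \<subseteq> Y" "pathstart w = y" "pathfinish w = f x"
  shows "induced_hom Y w f \<in> hom (pi1 X x) (pi1 Y y)"
proof (rule homI)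
  have image: "path (f \<circ> p) \<and> path_image (f \<circ> p) \<subseteq> Y \<and> pathstart (f \<circ> p) = f x \<and> pathfinish (f \<circ> p) = f x"
    if "p \<in> based_loops X x" for p
    using that f
    by (auto simp: based_loops_def pathstart_compose pathfinish_compose path_image_compose
        intro!: path_continuous_image intro: continuous_on_subset)
  have loop: "w +++ (f \<circ> p) +++ reversepath w \<in> based_loops Y y" if "p \<in> based_loops X x" for p
    using image[OF that] w by (auto simp: based_loops_def subset_path_image_join)
  fix A assume "A \<in> carrier (pi1 X x)"
  then obtain p where p: "p \<in> based_loops X x" "A = path_class X p"
    by (rule pi1_carrierE)
  show "induced_hom Y w f A \<in> carrier (pi1 Y y)"
    using loop[OF p(1)] by (simp add: p induced_hom_path_class[OF p(1) f] w pi1_carrierI)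
  fix B assume "B \<in> carrier (pi1 X x)"
  then obtain q where q: "q \<in> based_loops X x" "B = path_class X q"
    by (rule pi1_carrierE)
  have pq: "p +++ q \<in> based_loops X x"
    using p q by (simp add: based_loops_join)
  let ?a = "f \<circ> p" and ?b = "f \<circ> q" and ?v = "reversepath w"
  note ab = image[OF p(1)] image[OF q(1)]
  have "homotopic_paths Y ((w +++ ?a +++ ?v) +++ (w +++ ?b +++ ?v)) (w +++ (?a +++ ?v) +++ (w +++ ?b +++ ?v))"
    by (rule homotopic_paths_sym, rule homotopic_paths_assoc)
      (use w ab in \<open>auto simp: subset_path_image_join\<close>)
  \<comment> \<open>The cancellation lemma is applied behind the leading \<open>w\<close>, with
    \<open>?b +++ ?v\<close> as the path that follows the detour.\<close>
  also have "homotopic_paths Y \<dots> (w +++ ?a +++ ?b +++ ?v)"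
    by (intro homotopic_paths_join homotopic_paths_cancel)
      (use w ab in \<open>auto simp: subset_path_image_join\<close>)
  also have "homotopic_paths Y \<dots> (w +++ (?a +++ ?b) +++ ?v)"
    by (intro homotopic_paths_join homotopic_paths_assoc)
      (use w ab in \<open>auto simp: subset_path_image_join\<close>)
  also have "\<dots> = w +++ (f \<circ> (p +++ q)) +++ ?v"
    by (simp add: path_compose_join)
  finally show "induced_hom Y w f (A \<otimes>\<^bsub>pi1 X x\<^esub> B) =
      induced_hom Y w f A \<otimes>\<^bsub>pi1 Y y\<^esub> induced_hom Y w f B"
    unfolding p(2) q(2) pi1_mult[OF p(1) q(1)] induced_hom_path_class[OF p(1) f w(1,2,4)]
      induced_hom_path_class[OF q(1) f w(1,2,4)] induced_hom_path_class[OF pq f w(1,2,4)]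
      pi1_mult[OF loop[OF p(1)] loop[OF q(1)]]
    by (rule path_class_eqI[symmetric])
qed


section \<open>Reidemeister classes\<close>

text \<open>The relation is the orbit relation of the action of G on H in which z sends a to
  \<phi>(z) a \<psi>(z)^-1. The unit, inverses and products of G therefore supply the witnesses for
  reflexivity, symmetry and transitivity.\<close>

lemma equiv_reidemeister_rel2:
  assumes "group_hom G H \<phi>" "group_hom G H \<psi>"
  shows "equiv (carrier H) (reidemeister_rel2 G H \<phi> \<psi>)"
proof -
  interpret p: group_hom G H \<phi> by fact
  interpret q: group_hom G H \<psi> by fact
  show ?thesis
  proof (rule equivI)
    show "reidemeister_rel2 G H \<phi> \<psi> \<subseteq> carrier H \<times> carrier H"
      by (auto simp: reidemeister_rel2_def)
    show "refl_on (carrier H) (reidemeister_rel2 G H \<phi> \<psi>)"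
      by (force simp: refl_on_def reidemeister_rel2_def intro: bexI[of _ "\<one>\<^bsub>G\<^esub>"])
    show "sym (reidemeister_rel2 G H \<phi> \<psi>)"
    proof (rule symI)
      fix a b assume "(a, b) \<in> reidemeister_rel2 G H \<phi> \<psi>"
      then obtain z where z: "a \<in> carrier H" "b \<in> carrier H" "z \<in> carrier G"
        "b = \<phi> z \<otimes>\<^bsub>H\<^esub> a \<otimes>\<^bsub>H\<^esub> inv\<^bsub>H\<^esub> (\<psi> z)"
        by (auto simp: reidemeister_rel2_def)
      then have "a = \<phi> (inv\<^bsub>G\<^esub> z) \<otimes>\<^bsub>H\<^esub> b \<otimes>\<^bsub>H\<^esub> inv\<^bsub>H\<^esub> (\<psi> (inv\<^bsub>G\<^esub> z))"
        by (simp add: p.H.m_assoc p.H.inv_solve_left)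
      with z p.G.inv_closed[OF z(3)] show "(b, a) \<in> reidemeister_rel2 G H \<phi> \<psi>"
        unfolding reidemeister_rel2_def by blast
    qed
    show "trans (reidemeister_rel2 G H \<phi> \<psi>)"
    proof (rule transI)
      fix a b c
      assume "(a, b) \<in> reidemeister_rel2 G H \<phi> \<psi>" "(b, c) \<in> reidemeister_rel2 G H \<phi> \<psi>"
      then obtain z y where z: "a \<in> carrier H" "b \<in> carrier H" "c \<in> carrier H"
        "z \<in> carrier G" "b = \<phi> z \<otimes>\<^bsub>H\<^esub> a \<otimes>\<^bsub>H\<^esub> inv\<^bsub>H\<^esub> (\<psi> z)"
        "y \<in> carrier G" "c = \<phi> y \<otimes>\<^bsub>H\<^esub> b \<otimes>\<^bsub>H\<^esub> inv\<^bsub>H\<^esub> (\<psi> y)"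
        by (auto simp: reidemeister_rel2_def)
      then have "c = \<phi> (y \<otimes>\<^bsub>G\<^esub> z) \<otimes>\<^bsub>H\<^esub> a \<otimes>\<^bsub>H\<^esub> inv\<^bsub>H\<^esub> (\<psi> (y \<otimes>\<^bsub>G\<^esub> z))"
        by (simp add: p.H.m_assoc p.H.inv_mult_group)
      with z p.G.m_closed[OF z(6,4)] show "(a, c) \<in> reidemeister_rel2 G H \<phi> \<psi>"
        unfolding reidemeister_rel2_def by blast
    qed
  qed
qed

text \<open>One \<open>z\<close> serves all coordinates of a tuple simultaneously, in particular
  coordinate \<open>j\<close>. Conversely, relations in separate coordinates may come from different
  elements \<open>z\<close>; this is why the map on classes can fail to be injective and only an
  inequality of Reidemeister numbers results.\<close>

lemma reidemeister_rel_component: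
  assumes "(\<alpha>, \<beta>) \<in> reidemeister_rel G H k \<phi>" "j \<in> {2..k}"
  shows "(\<alpha> j, \<beta> j) \<in> reidemeister_rel2 G H (\<phi> 1) (\<phi> j)"
  using assms by (auto simp: reidemeister_rel_def reidemeister_rel2_def tuples_def)

lemma reidemeister_rel_refl:
  assumes "k \<ge> 2" "\<forall>i\<in>{1..k}. group_hom G H (\<phi> i)" "\<alpha> \<in> tuples H k"
  shows "(\<alpha>, \<alpha>) \<in> reidemeister_rel G H k \<phi>"
proof -
  interpret p: group_hom G H "\<phi> 1" using assms by simp
  have "\<phi> 1 \<one>\<^bsub>G\<^esub> \<otimes>\<^bsub>H\<^esub> \<alpha> i \<otimes>\<^bsub>H\<^esub> inv\<^bsub>H\<^esub> (\<phi> i \<one>\<^bsub>G\<^esub>) = \<alpha> i" if "i \<in> {2..k}" for i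
  proof -
    interpret q: group_hom G H "\<phi> i" using assms that by simp
    have "\<alpha> i \<in> carrier H" using assms that by (auto simp: tuples_def)
    then show ?thesis using p.hom_one by simp
  qed
  then show ?thesis
    using assms by (auto simp: reidemeister_rel_def intro!: bexI[of _ "\<one>\<^bsub>G\<^esub>"])
qed

lemma reidemeister_components_surjection:
  assumes k: "k \<ge> 2" and hom: "\<forall>i\<in>{1..k}. group_hom G H (\<phi> i)"
  shows "\<exists>\<Psi>. (\<forall>\<alpha>\<in>tuples H k. \<Psi> (reidemeister_rel G H k \<phi> `` {\<alpha>}) =
        (\<lambda>j\<in>{2..k}. reidemeister_rel2 G H (\<phi> 1) (\<phi> j) `` {\<alpha> j})) \<and>
      \<Psi> ` reidemeister_classes G H k \<phi> = (\<Pi>\<^sub>E j\<in>{2..k}. reidemeister_classes2 G H (\<phi> 1) (\<phi> j))"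
proof (intro exI conjI ballI)
  let ?R = "reidemeister_rel G H k \<phi>"
  let ?R2 = "\<lambda>j. reidemeister_rel2 G H (\<phi> 1) (\<phi> j)"
  \<comment> \<open>The witness avoids choosing representatives: component \<open>j\<close> is the
    union of the classes of the \<open>j\<close>-th coordinates of all members of \<open>C\<close>.
    Well-definedness becomes the claim that this union is a single class. The restriction to
    \<open>{2..k}\<close> makes the value an element of the extensional product.\<close>
  let ?\<Psi> = "\<lambda>C. \<lambda>j\<in>{2..k}. ?R2 j `` ((\<lambda>\<alpha>. \<alpha> j) ` C)"
  show eq: "?\<Psi> (?R `` {\<alpha>}) = (\<lambda>j\<in>{2..k}. ?R2 j `` {\<alpha> j})" if \<alpha>: "\<alpha> \<in> tuples H k" for \<alpha>
  proof (rule restrict_ext)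
    fix j assume j: "j \<in> {2..k}"
    have equiv: "equiv (carrier H) (?R2 j)"
      using j k hom by (intro equiv_reidemeister_rel2) auto
    have "?R2 j `` {\<beta> j} = ?R2 j `` {\<alpha> j}" if "\<beta> \<in> ?R `` {\<alpha>}" for \<beta>
      using equiv_class_eq[OF equiv] reidemeister_rel_component[OF _ j] that by blast
    \<comment> \<open>All sets in the union equal the class of \<open>\<alpha> j\<close>; this
      member ensures that the union is not empty.\<close>
    moreover have "\<alpha> \<in> ?R `` {\<alpha>}"
      using reidemeister_rel_refl[OF k hom \<alpha>] by simp
    ultimately show "?R2 j `` ((\<lambda>\<alpha>. \<alpha> j) ` (?R `` {\<alpha>})) = ?R2 j `` {\<alpha> j}"
      by blast
  qed
  show "?\<Psi> ` reidemeister_classes G H k \<phi> = (\<Pi>\<^sub>E j\<in>{2..k}. reidemeister_classes2 G H (\<phi> 1) (\<phi> j))"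
  proof (intro subset_antisym subsetI)
    fix c assume "c \<in> ?\<Psi> ` reidemeister_classes G H k \<phi>"
    then obtain \<alpha> where "\<alpha> \<in> tuples H k" "c = ?\<Psi> (?R `` {\<alpha>})"
      unfolding reidemeister_classes_def by (blast elim: quotientE)
    then show "c \<in> (\<Pi>\<^sub>E j\<in>{2..k}. reidemeister_classes2 G H (\<phi> 1) (\<phi> j))"
      using eq by (auto simp: reidemeister_classes2_def tuples_def intro!: quotientI)
  next
    fix c assume c: "c \<in> (\<Pi>\<^sub>E j\<in>{2..k}. reidemeister_classes2 G H (\<phi> 1) (\<phi> j))"
    then have "\<forall>j\<in>{2..k}. \<exists>a\<in>carrier H. c j = ?R2 j `` {a}"
      by (auto simp: reidemeister_classes2_def quotient_def PiE_iff)
    then obtain a where a: "\<And>j. j \<in> {2..k} \<Longrightarrow> a j \<in> carrier H \<and> c j = ?R2 j `` {a j}"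
      by metis
    \<comment> \<open>The coordinates of a preimage are chosen independently, since every tuple over
      H is allowed. Restricting to \<open>{2..k}\<close> makes the choice function extensional, as
      \<open>tuples\<close> demands.\<close>
    define \<alpha> where "\<alpha> = restrict a {2..k}"
    have \<alpha>: "\<alpha> \<in> tuples H k"
      using a by (auto simp: tuples_def \<alpha>_def)
    have "c = (\<lambda>j\<in>{2..k}. ?R2 j `` {\<alpha> j})"
      using c a by (intro PiE_ext[OF c]) (auto simp: \<alpha>_def PiE_iff)
    then show "c \<in> ?\<Psi> ` reidemeister_classes G H k \<phi>"
      using quotientI[OF \<alpha>, of ?R] unfolding reidemeister_classes_def
      by (intro image_eqI[where x = "?R `` {\<alpha>}"]) (simp_all only: eq[OF \<alpha>])
  qed
qed

section \<open>Counting in the extended natural numbers\<close>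

lemma prod_enat: "(\<Prod>i\<in>I. enat (g i)) = enat (\<Prod>i\<in>I. g i)"
  \<comment> \<open>Both products are 1 when \<open>I\<close> is empty and, by convention, when
    \<open>I\<close> is infinite; \<open>one_enat_def\<close> identifies the two units.\<close>
  by (induction I rule: infinite_finite_induct) (simp_all add: one_enat_def)

text \<open>The product is an image of the finite set \<open>A\<close>, hence finite with at most
  \<open>card A\<close> elements. Finiteness passes to each factor because no factor is empty: one
  empty factor would make the product empty whatever the size of the others.\<close>

lemma ecard_surj_PiE:
  assumes surj: "\<Psi> ` A = Pi\<^sub>E I B" and A: "ecard A < \<infinity>" and I: "finite I"
    and nonempty: "\<And>i. i \<in> I \<Longrightarrow> B i \<noteq> {}"
  shows "\<forall>i\<in>I. ecard (B i) < \<infinity>" "(\<Prod>i\<in>I. ecard (B i)) \<le> ecard A"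
proof -
  have fin: "finite A"
    using A by (auto simp: ecard_def split: if_splits)
  then have "finite (Pi\<^sub>E I B)"
    by (simp flip: surj)
  moreover have "Pi\<^sub>E I B \<noteq> {}"
    using nonempty by (simp add: PiE_eq_empty_iff)
  ultimately have B: "finite (B i)" if "i \<in> I" for i
    using that by (simp add: finite_PiE_iff)
  then show "\<forall>i\<in>I. ecard (B i) < \<infinity>"
    by (simp add: ecard_def)
  have "(\<Prod>i\<in>I. card (B i)) \<le> card A"
    using card_image_le[OF fin, of \<Psi>] card_PiE[OF I, of B] by (simp add: surj)
  moreover have "(\<Prod>i\<in>I. ecard (B i)) = enat (\<Prod>i\<in>I. card (B i))"
    using B by (simp add: ecard_def flip: prod_enat)
  ultimately show "(\<Prod>i\<in>I. ecard (B i)) \<le> ecard A"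
    using fin by (simp add: ecard_def)
qed

theorem mainTheorem4:
  fixes X :: "'a::topological_space set" and Y :: "'b::topological_space set"
    and k :: nat and f :: "nat \<Rightarrow> 'a \<Rightarrow> 'b"
    and x0 :: 'a and y0 :: 'b and w :: "nat \<Rightarrow> real \<Rightarrow> 'b"
    and \<phi> :: "nat \<Rightarrow> (real \<Rightarrow> 'a) set \<Rightarrow> (real \<Rightarrow> 'b) set"
  assumes X: "connected X" "locally path_connected X" "semilocally_simply_connected X"
    and Y: "connected Y" "locally path_connected Y" "semilocally_simply_connected Y"
    and base_points: "x0 \<in> X" "y0 \<in> Y"
    and k: "k \<ge> 2"
    and f: "\<And>i. i \<in> {1..k} \<Longrightarrow> continuous_on X (f i) \<and> f i \<in> X \<rightarrow> Y"
    and w: "\<And>i. i \<in> {1..k} \<Longrightarrow>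
      path (w i) \<and> path_image (w i) \<subseteq> Y \<and> pathstart (w i) = y0 \<and> pathfinish (w i) = f i x0"
    and \<phi>: "\<And>i. i \<in> {1..k} \<Longrightarrow> \<phi> i = induced_hom Y (w i) (f i)"
  defines "G \<equiv> pi1 X x0" and "H \<equiv> pi1 Y y0"
  shows "(\<exists>\<Psi> \<in> reidemeister_classes G H k \<phi> \<rightarrow>
            (\<Pi>\<^sub>E j\<in>{2..k}. reidemeister_classes2 G H (\<phi> 1) (\<phi> j)).
          (\<forall>\<alpha>\<in>tuples H k.
            \<Psi> (reidemeister_rel G H k \<phi> `` {\<alpha>}) =
              (\<lambda>j\<in>{2..k}. reidemeister_rel2 G H (\<phi> 1) (\<phi> j) `` {\<alpha> j})) \<and>
          \<Psi> ` reidemeister_classes G H k \<phi> =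
            (\<Pi>\<^sub>E j\<in>{2..k}. reidemeister_classes2 G H (\<phi> 1) (\<phi> j))) \<and>
    (reidemeister_number G H k \<phi> < \<infinity> \<longrightarrow>
      (\<forall>j\<in>{2..k}. reidemeister_number2 G H (\<phi> 1) (\<phi> j) < \<infinity>) \<and>
      reidemeister_number G H k \<phi> \<ge> (\<Prod>j=2..k. reidemeister_number2 G H (\<phi> 1) (\<phi> j)))"
proof -
  have group: "group G" "group H"
    using group_pi1 base_points by (auto simp: G_def H_def)
  \<comment> \<open>The paths \<open>w i\<close> turn the maps into homomorphisms between the groups
    at \<open>x0\<close> and \<open>y0\<close>. From here on the argument is about group
    homomorphisms and finite counting.\<close>
  have hom: "\<forall>i\<in>{1..k}. group_hom G H (\<phi> i)"
  proof
    fix i assume i: "i \<in> {1..k}"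
    show "group_hom G H (\<phi> i)"
      using group induced_hom_hom[OF base_points(1), of "f i" Y "w i" y0] f[OF i] w[OF i]
      by (simp add: group_hom_def group_hom_axioms_def \<phi>[OF i] G_def H_def)
  qed
  obtain \<Psi> where eq: "\<forall>\<alpha>\<in>tuples H k. \<Psi> (reidemeister_rel G H k \<phi> `` {\<alpha>}) =
      (\<lambda>j\<in>{2..k}. reidemeister_rel2 G H (\<phi> 1) (\<phi> j) `` {\<alpha> j})"
    and surj: "\<Psi> ` reidemeister_classes G H k \<phi> =
      (\<Pi>\<^sub>E j\<in>{2..k}. reidemeister_classes2 G H (\<phi> 1) (\<phi> j))"
    using reidemeister_components_surjection[OF k hom] by (elim exE conjE)
  \<comment> \<open>The class of the unit of \<open>H\<close> is an element; the counting lemma asks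
    for nonempty factors.\<close>
  have nonempty: "reidemeister_classes2 G H (\<phi> 1) (\<phi> j) \<noteq> {}" for j
    using monoid.one_closed[OF group.is_monoid[OF group(2)]]
    unfolding reidemeister_classes2_def quotient_def by blast
  show ?thesis
    unfolding reidemeister_number_def reidemeister_number2_def
  proof (intro conjI impI bexI)
    show "\<Psi> \<in> reidemeister_classes G H k \<phi> \<rightarrow> (\<Pi>\<^sub>E j\<in>{2..k}. reidemeister_classes2 G H (\<phi> 1) (\<phi> j))"
      \<comment> \<open>That \<open>\<Psi>\<close> lands in the product is read off from the
        equation for its image.\<close>
      by (rule funcsetI) (metis imageI surj)
    assume "ecard (reidemeister_classes G H k \<phi>) < \<infinity>"
    note bound = ecard_surj_PiE[OF surj this finite_atLeastAtMost nonempty]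
    show "\<forall>j\<in>{2..k}. ecard (reidemeister_classes2 G H (\<phi> 1) (\<phi> j)) < \<infinity>"
      by (rule bound(1))
    show "(\<Prod>j=2..k. ecard (reidemeister_classes2 G H (\<phi> 1) (\<phi> j))) \<le> ecard (reidemeister_classes G H k \<phi>)"
      by (rule bound(2))
  qed (rule eq surj)+
qed

end
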